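(* Let $A=\begin{bmatrix} a & b\\ c& d\end{bmatrix}$ be a real $2\times2$ constant matrix with eigenvalues $\lambda=\alpha\pm i\beta$, where $\alpha,\beta\in\mathbb{R}$, $\alpha\neq0$ and $\beta>0$. Then the system $\boldsymbol{x}'(t)=A\boldsymbol{x}(t)$, $t\in\mathbb{R}$, is Hyers-Ulam stable on $\mathbb{R}$, with HUS constant $$K=\frac{\sqrt{\beta^2+\left(|a-\alpha|+\max\{|b|,|c|\}\right)^2}}{|\alpha|\beta}.$$
   Context: For $\boldsymbol{v}=(v_1,v_2)^T\in\mathbb{R}^2$, $\|\boldsymbol{v}\|_\infty=\max\{|v_1|,|v_2|\}$. The system $\boldsymbol{x}'=A\boldsymbol{x}$ is Hyers-Ulam stable on $\mathbb{R}$ with Hyers-Ulam stability (HUS) constant $K>0$ if for every $\varepsilon>0$ and every differentiable $\boldsymbol{\phi}:\mathbb{R}\to\mathbb{R}^2$ with $\|\boldsymbol{\phi}'(t)-A\boldsymbol{\phi}(t)\|_\infty\le\varepsilon$ for all $t\in\mathbb{R}$, there exists a solution $\boldsymbol{x}:\mathbb{R}\to\mathbb{R}^2$ of $\boldsymbol{x}'=A\boldsymbol{x}$ with $\|\boldsymbol{\phi}(t)-\boldsymbol{x}(t)\|_\infty\le K\varepsilon$ for all $t\in\mathbb{R}$. (The constant $K$ does not depend on $\varepsilon$ or $\boldsymbol{\phi}$.) *)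

theory Defs
  imports "HOL-Analysis.Analysis"
begin

(* Eigenvalues of a real matrix are those of its complexification, so that non-real ones count. *)
definition complex_matrix :: "real ^ 'n ^ 'm \<Rightarrow> complex ^ 'n ^ 'm" where
  "complex_matrix A = (\<chi> i j. complex_of_real (A $ i $ j))"

definition eigenvalues :: "complex ^ 'n ^ 'n \<Rightarrow> complex set" where
  "eigenvalues M = {l. \<exists>v. v \<noteq> 0 \<and> M *v v = l *s v}"

definition solves_linear_system :: "real ^ 2 ^ 2 \<Rightarrow> (real \<Rightarrow> real ^ 2) \<Rightarrow> bool" where
  "solves_linear_system A x \<longleftrightarrow> (\<forall>t. (x has_vector_derivative A *v x t) (at t))"

(* infnorm is the maximum norm (see infnorm_2); norm on real ^ 2 would be Euclidean. *)
definition hyers_ulam_stable_with :: "real ^ 2 ^ 2 \<Rightarrow> real \<Rightarrow> bool" where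
  "hyers_ulam_stable_with A K \<longleftrightarrow>
     K > 0 \<and>
     (\<forall>\<epsilon>>0. \<forall>\<phi> :: real \<Rightarrow> real ^ 2.
        (\<forall>t. \<phi> differentiable (at t)) \<longrightarrow>
        (\<forall>t. infnorm (vector_derivative \<phi> (at t) - A *v \<phi> t) \<le> \<epsilon>) \<longrightarrow>
        (\<exists>x. solves_linear_system A x \<and> (\<forall>t. infnorm (\<phi> t - x t) \<le> K * \<epsilon>)))"

end

theory Submission
  imports Defs
begin

text \<open>
  Write \<open>A = \<alpha> I + N\<close>. The eigenvalue hypothesis says that \<open>A\<close> has trace \<open>2 \<alpha>\<close> and determinant
  \<open>\<alpha>\<^sup>2 + \<beta>\<^sup>2\<close>, that is, \<open>N\<^sup>2 = - \<beta>\<^sup>2 I\<close> (lemma \<open>complex_eigenvalue_2x2\<close>). Hence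
  \<open>exp (t A) = exp (\<alpha> t) (cos (\<beta> t) I + (sin (\<beta> t) / \<beta>) N)\<close>. In the maximum norm \<open>N\<close> has operator
  norm at most \<open>M = \<bar>a - \<alpha>\<bar> + max \<bar>b\<bar> \<bar>c\<bar>\<close>, and \<open>\<bar>cos \<theta>\<bar> + \<bar>sin \<theta>\<bar> M / \<beta> \<le> sqrt (1 + (M / \<beta>)\<^sup>2)\<close> by the
  Cauchy-Schwarz inequality, so \<open>exp (t A)\<close> has norm at most \<open>C exp (\<alpha> t)\<close> with
  \<open>C = sqrt (\<beta>\<^sup>2 + M\<^sup>2) / \<beta>\<close> (lemma \<open>infnorm_flow_le\<close>).

  Let \<open>\<alpha> > 0\<close> and let \<open>q = \<phi>' - A \<phi>\<close> be bounded by \<open>\<epsilon>\<close>. Then \<open>s \<mapsto> exp ((t - s) A) \<phi>(s)\<close> has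
  the derivative \<open>exp ((t - s) A) q(s)\<close>, of norm at most \<open>C \<epsilon> exp (\<alpha> (t - s))\<close>. Since this bound decays
  in \<open>s\<close>, the function has a limit as \<open>s \<rightarrow> \<infinity>\<close>, at distance at most \<open>C \<epsilon> / \<alpha>\<close> from its
  value \<open>\<phi>(t)\<close> at \<open>s = t\<close>. The limit is \<open>exp (t A) x\<^sub>0\<close>, where \<open>x\<^sub>0\<close> is the limit for \<open>t = 0\<close>; as a
  function of \<open>t\<close> it is the required solution, and \<open>C / \<alpha>\<close> is the claimed constant. The case \<open>\<alpha> < 0\<close>
  follows by reversing time, which replaces \<open>A\<close> by \<open>- A\<close>.
\<close>

section \<open>Functions with exponentially decaying derivative\<close>

text \<open>
  The derivative need not be integrable in the sense of Riemann or Lebesgue, so no integral is used: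
  \<open>u - (B/k) exp (- k s)\<close> is nondecreasing and \<open>u + (B/k) exp (- k s)\<close> is nonincreasing, and any
  number squeezed between the two functions is the limit.
\<close>

lemma exp_decaying_derivative_limit_real:
  fixes u u' :: "real \<Rightarrow> real"
  assumes der: "\<And>s. (u has_real_derivative u' s) (at s)"
    and bound: "\<And>s. \<bar>u' s\<bar> \<le> B * exp (- k * s)" and "k > 0"
  shows "\<exists>L. (u \<longlongrightarrow> L) at_top \<and> (\<forall>s. \<bar>u s - L\<bar> \<le> B / k * exp (- k * s))"
proof -
  define lo where "lo s = u s - B / k * exp (- k * s)" for s
  define hi where "hi s = u s + B / k * exp (- k * s)" for s
  have lo_mono: "lo s \<le> lo t" if "s \<le> t" for s t
  proof (rule DERIV_nonneg_imp_nondecreasing[OF that])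
    fix x
    have "(lo has_real_derivative u' x + B * exp (- k * x)) (at x)"
      unfolding lo_def using \<open>k > 0\<close> by (auto intro!: derivative_eq_intros der)
    moreover have "0 \<le> u' x + B * exp (- k * x)" using bound[of x] by linarith
    ultimately show "\<exists>y. (lo has_real_derivative y) (at x) \<and> 0 \<le> y" by blast
  qed
  have hi_antimono: "hi t \<le> hi s" if "s \<le> t" for s t
  proof (rule DERIV_nonpos_imp_nonincreasing[OF that])
    fix x
    have "(hi has_real_derivative u' x - B * exp (- k * x)) (at x)"
      unfolding hi_def using \<open>k > 0\<close> by (auto intro!: derivative_eq_intros der)
    moreover have "u' x - B * exp (- k * x) \<le> 0" using bound[of x] by linarith
    ultimately show "\<exists>y. (hi has_real_derivative y) (at x) \<and> y \<le> 0" by blast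
  qed
  have "0 \<le> B" using bound[of 0] by simp
  then have lo_le_hi: "lo s \<le> hi s" for s using \<open>k > 0\<close> by (simp add: lo_def hi_def)
  have lo_le: "lo s \<le> hi t" for s t
    using lo_mono[of s "max s t"] hi_antimono[of t "max s t"] lo_le_hi[of "max s t"] by simp
  define L where "L = (SUP s. lo s)"
  have "bdd_above (range lo)" using lo_le by (auto simp: bdd_above_def)
  then have "lo s \<le> L" for s unfolding L_def by (intro cSUP_upper) auto
  moreover have "L \<le> hi s" for s unfolding L_def using lo_le by (intro cSUP_least) auto
  ultimately have close: "\<bar>u s - L\<bar> \<le> B / k * exp (- k * s)" for s
    unfolding lo_def hi_def by (smt (verit))
  have "((\<lambda>s. B / k * exp (- k * s)) \<longlongrightarrow> 0) at_top"
    using \<open>k > 0\<close>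
    by (intro tendsto_mult_right_zero filterlim_compose[OF exp_at_bot]
        filterlim_tendsto_neg_mult_at_bot[OF tendsto_const] filterlim_ident) auto
  then have "((\<lambda>s. u s - L) \<longlongrightarrow> 0) at_top"
    by (rule Lim_null_comparison[rotated]) (use close in auto)
  then have "(u \<longlongrightarrow> L) at_top" by (simp add: LIM_zero_iff)
  with close show ?thesis by blast
qed

lemma exp_decaying_derivative_limit:
  fixes g g' :: "real \<Rightarrow> real ^ 2"
  assumes der: "\<And>s. (g has_vector_derivative g' s) (at s)"
    and bound: "\<And>s. infnorm (g' s) \<le> B * exp (- k * s)" and "k > 0"
  shows "\<exists>L. (g \<longlongrightarrow> L) at_top \<and> (\<forall>s. infnorm (g s - L) \<le> B / k * exp (- k * s))"
proof -
  have "\<exists>l. ((\<lambda>s. g s $ i) \<longlongrightarrow> l) at_top \<and> (\<forall>s. \<bar>g s $ i - l\<bar> \<le> B / k * exp (- k * s))" for i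
  proof (rule exp_decaying_derivative_limit_real[OF _ _ \<open>k > 0\<close>])
    fix s
    show "((\<lambda>s. g s $ i) has_real_derivative g' s $ i) (at s)"
      using bounded_linear.has_vector_derivative[OF bounded_linear_vec_nth der[of s]]
      by (simp add: has_real_derivative_iff_has_vector_derivative)
    show "\<bar>g' s $ i\<bar> \<le> B * exp (- k * s)"
      using component_le_infnorm_cart[of "g' s" i] bound[of s] by linarith
  qed
  then obtain l where l: "\<And>i. ((\<lambda>s. g s $ i) \<longlongrightarrow> l i) at_top"
      "\<And>i s. \<bar>g s $ i - l i\<bar> \<le> B / k * exp (- k * s)"
    by metis
  have "(g \<longlongrightarrow> (\<chi> i. l i)) at_top" by (rule vec_tendstoI) (simp add: l)
  moreover have "infnorm (g s - (\<chi> i. l i)) \<le> B / k * exp (- k * s)" for s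
    unfolding infnorm_2 using l(2) by simp
  ultimately show ?thesis by blast
qed

section \<open>The flow of a matrix with a complex pair of eigenvalues\<close>

text \<open>This is \<open>exp (t (\<alpha> I + N)) v\<close> when \<open>N\<^sup>2 = - \<beta>\<^sup>2 I\<close>, by the power series of \<open>cos\<close> and \<open>sin\<close>.\<close>

definition flow :: "real \<Rightarrow> real \<Rightarrow> real ^ 2 ^ 2 \<Rightarrow> real \<Rightarrow> real ^ 2 \<Rightarrow> real ^ 2" where
  "flow \<alpha> \<beta> N t v =
     exp (\<alpha> * t) *\<^sub>R (cos (\<beta> * t) *\<^sub>R v + (sin (\<beta> * t) / \<beta>) *\<^sub>R (N *v v))"

lemma flow_0: "flow \<alpha> \<beta> N 0 v = v"
  by (simp add: flow_def)

lemma bounded_linear_flow: "bounded_linear (flow \<alpha> \<beta> N t)"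
  unfolding flow_def
  by (intro bounded_linear_const_scaleR bounded_linear_add bounded_linear_ident
      matrix_vector_mul_bounded_linear)

lemma flow_add:
  assumes sq: "\<And>v. N *v (N *v v) = - \<beta>\<^sup>2 *\<^sub>R v" and "\<beta> \<noteq> 0"
  shows "flow \<alpha> \<beta> N (s + t) v = flow \<alpha> \<beta> N s (flow \<alpha> \<beta> N t v)"
  using \<open>\<beta> \<noteq> 0\<close>
  by (simp add: flow_def matrix_vector_right_distrib matrix_vector_mult_scaleR sq distrib_left
      exp_add cos_add sin_add vec_eq_iff field_simps power2_eq_square)

lemma matrix_vector_mult_flow:
  assumes "\<And>v. A *v v = \<alpha> *\<^sub>R v + N *v v"
  shows "A *v flow \<alpha> \<beta> N t v = flow \<alpha> \<beta> N t (A *v v)"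
  by (simp add: assms flow_def matrix_vector_right_distrib matrix_vector_mult_scaleR algebra_simps)

lemma has_vector_derivative_flow:
  assumes sq: "\<And>v. N *v (N *v v) = - \<beta>\<^sup>2 *\<^sub>R v" and "\<beta> \<noteq> 0"
    and A: "\<And>v. A *v v = \<alpha> *\<^sub>R v + N *v v"
    and f: "(f has_real_derivative f') (at s)"
    and w: "(w has_vector_derivative w') (at s)"
  shows "((\<lambda>s. flow \<alpha> \<beta> N (f s) (w s)) has_vector_derivative
           flow \<alpha> \<beta> N (f s) (w' + f' *\<^sub>R (A *v w s))) (at s)"
proof -
  have Nw: "((\<lambda>s. N *v w s) has_vector_derivative N *v w') (at s)"
    by (rule bounded_linear.has_vector_derivative[OF matrix_vector_mul_bounded_linear w])
  have e: "((\<lambda>s. exp (\<alpha> * f s)) has_real_derivative \<alpha> * f' * exp (\<alpha> * f s)) (at s)"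
    and c: "((\<lambda>s. cos (\<beta> * f s)) has_real_derivative - (\<beta> * f' * sin (\<beta> * f s))) (at s)"
    and i: "((\<lambda>s. sin (\<beta> * f s) / \<beta>) has_real_derivative f' * cos (\<beta> * f s)) (at s)"
    using \<open>\<beta> \<noteq> 0\<close> by (auto intro!: derivative_eq_intros f)
  show ?thesis
    unfolding flow_def
    apply (rule has_vector_derivative_eq_rhs)
     apply (rule has_vector_derivative_scaleR[OF e has_vector_derivative_add[OF
             has_vector_derivative_scaleR[OF c w] has_vector_derivative_scaleR[OF i Nw]]])
    using \<open>\<beta> \<noteq> 0\<close>
    by (simp add: A sq matrix_vector_right_distrib matrix_vector_mult_scaleR vec_eq_iff
        field_simps power2_eq_square)
qed

lemma abs_cos_add_abs_sin_le:
  fixes \<theta> k :: real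
  shows "\<bar>cos \<theta>\<bar> + \<bar>sin \<theta>\<bar> * k \<le> sqrt (1 + k\<^sup>2)"
proof (rule real_le_rsqrt)
  \<comment> \<open>Lagrange's identity; dropping the second square is the Cauchy-Schwarz inequality.\<close>
  have "(\<bar>cos \<theta>\<bar> + \<bar>sin \<theta>\<bar> * k)\<^sup>2 + (\<bar>sin \<theta>\<bar> - \<bar>cos \<theta>\<bar> * k)\<^sup>2
      = ((sin \<theta>)\<^sup>2 + (cos \<theta>)\<^sup>2) * (1 + k\<^sup>2)"
    by (simp add: power2_sum power2_diff power_mult_distrib distrib_left distrib_right
        del: sin_cos_squared_add sin_cos_squared_add2)
  also have "\<dots> = 1 + k\<^sup>2" by simp
  finally show "(\<bar>cos \<theta>\<bar> + \<bar>sin \<theta>\<bar> * k)\<^sup>2 \<le> 1 + k\<^sup>2"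
    by (smt (verit) zero_le_power2)
qed

lemma infnorm_flow_le:
  assumes N: "\<And>v. infnorm (N *v v) \<le> M * infnorm v" and "\<beta> > 0"
  shows "infnorm (flow \<alpha> \<beta> N t v) \<le> exp (\<alpha> * t) * (sqrt (\<beta>\<^sup>2 + M\<^sup>2) / \<beta>) * infnorm v"
proof -
  have "infnorm (flow \<alpha> \<beta> N t v)
      \<le> exp (\<alpha> * t) * (\<bar>cos (\<beta> * t)\<bar> * infnorm v + \<bar>sin (\<beta> * t) / \<beta>\<bar> * infnorm (N *v v))"
    unfolding flow_def infnorm_mul abs_exp_cancel
    by (intro mult_left_mono order_trans[OF infnorm_triangle]) (simp_all add: infnorm_mul)
  also have "\<dots> \<le> exp (\<alpha> * t) * (\<bar>cos (\<beta> * t)\<bar> * infnorm v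
      + \<bar>sin (\<beta> * t) / \<beta>\<bar> * (M * infnorm v))"
    by (intro mult_left_mono add_left_mono N) simp_all
  also have "\<dots> = exp (\<alpha> * t) * (\<bar>cos (\<beta> * t)\<bar> + \<bar>sin (\<beta> * t)\<bar> * (M / \<beta>)) * infnorm v"
    using \<open>\<beta> > 0\<close> by (simp add: field_simps)
  also have "\<dots> \<le> exp (\<alpha> * t) * sqrt (1 + (M / \<beta>)\<^sup>2) * infnorm v"
    by (intro mult_right_mono mult_left_mono abs_cos_add_abs_sin_le infnorm_pos_le) simp
  also have "1 + (M / \<beta>)\<^sup>2 = (\<beta>\<^sup>2 + M\<^sup>2) / \<beta>\<^sup>2"
    using \<open>\<beta> > 0\<close> by (simp add: field_simps)
  finally show ?thesis using \<open>\<beta> > 0\<close> by (simp add: real_sqrt_divide)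
qed

section \<open>Stability\<close>

text \<open>Every solution other than the constructed one drifts away from \<open>\<phi>\<close> as \<open>t \<rightarrow> \<infinity>\<close>, so it has to be
  selected by its behaviour there: flowing \<open>\<phi>(s)\<close> back to time \<open>t\<close> contracts errors made
  at late times \<open>s\<close>, and the result converges as \<open>s \<rightarrow> \<infinity>\<close>.\<close>

lemma hyers_ulam_stable_expanding:
  fixes A N :: "real ^ 2 ^ 2"
  assumes A: "\<And>v. A *v v = \<alpha> *\<^sub>R v + N *v v"
    and sq: "\<And>v. N *v (N *v v) = - \<beta>\<^sup>2 *\<^sub>R v"
    and N: "\<And>v. infnorm (N *v v) \<le> M * infnorm v"
    and "\<alpha> > 0" and "\<beta> > 0"
  shows "hyers_ulam_stable_with A (sqrt (\<beta>\<^sup>2 + M\<^sup>2) / (\<alpha> * \<beta>))"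
  unfolding hyers_ulam_stable_with_def
proof (intro conjI allI impI)
  show "sqrt (\<beta>\<^sup>2 + M\<^sup>2) / (\<alpha> * \<beta>) > 0"
    using \<open>\<alpha> > 0\<close> \<open>\<beta> > 0\<close> by (simp add: add_pos_nonneg)
next
  fix \<epsilon> :: real and \<phi> :: "real \<Rightarrow> real ^ 2"
  assume "\<epsilon> > 0" and diff: "\<forall>t. \<phi> differentiable (at t)"
    and defect: "\<forall>t. infnorm (vector_derivative \<phi> (at t) - A *v \<phi> t) \<le> \<epsilon>"
  define C where "C = sqrt (\<beta>\<^sup>2 + M\<^sup>2) / \<beta>"
  define q where "q s = vector_derivative \<phi> (at s) - A *v \<phi> s" for s
  let ?E = "flow \<alpha> \<beta> N"
  have "\<beta> \<noteq> 0" and "C \<ge> 0" using \<open>\<beta> > 0\<close> by (simp_all add: C_def)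
  have limit: "\<exists>L. ((\<lambda>s. ?E (t - s) (\<phi> s)) \<longlongrightarrow> L) at_top \<and>
      (\<forall>s. infnorm (?E (t - s) (\<phi> s) - L) \<le> exp (\<alpha> * t) * C * \<epsilon> / \<alpha> * exp (- \<alpha> * s))" for t
  proof (rule exp_decaying_derivative_limit[OF _ _ \<open>\<alpha> > 0\<close>])
    fix s
    have "((\<lambda>s. t - s) has_real_derivative - 1) (at s)"
      by (auto intro!: derivative_eq_intros)
    moreover have "(\<phi> has_vector_derivative vector_derivative \<phi> (at s)) (at s)"
      using diff by (simp add: vector_derivative_works)
    ultimately have "((\<lambda>s. ?E (t - s) (\<phi> s)) has_vector_derivative
        ?E (t - s) (vector_derivative \<phi> (at s) + (- 1) *\<^sub>R (A *v \<phi> s))) (at s)"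
      by (rule has_vector_derivative_flow[OF sq \<open>\<beta> \<noteq> 0\<close> A])
    then show "((\<lambda>s. ?E (t - s) (\<phi> s)) has_vector_derivative ?E (t - s) (q s)) (at s)"
      by (simp add: q_def)
    have "infnorm (?E (t - s) (q s)) \<le> exp (\<alpha> * (t - s)) * C * infnorm (q s)"
      unfolding C_def by (rule infnorm_flow_le[OF N \<open>\<beta> > 0\<close>])
    also have "\<dots> \<le> exp (\<alpha> * (t - s)) * C * \<epsilon>"
      using defect \<open>C \<ge> 0\<close> by (intro mult_left_mono) (simp_all add: q_def)
    also have "\<dots> = exp (\<alpha> * t) * C * \<epsilon> * exp (- \<alpha> * s)"
      by (simp add: right_diff_distrib exp_diff exp_minus divide_simps)
    finally show "infnorm (?E (t - s) (q s)) \<le> exp (\<alpha> * t) * C * \<epsilon> * exp (- \<alpha> * s)" .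
  qed
  obtain x0 where x0: "((\<lambda>s. ?E (0 - s) (\<phi> s)) \<longlongrightarrow> x0) at_top"
    using limit[of 0] by blast
  define x where "x t = ?E t x0" for t
  have "solves_linear_system A x"
    unfolding solves_linear_system_def
  proof
    fix t
    have "(x has_vector_derivative ?E t (0 + 1 *\<^sub>R (A *v x0))) (at t)"
      unfolding x_def
      by (rule has_vector_derivative_flow[OF sq \<open>\<beta> \<noteq> 0\<close> A DERIV_ident has_vector_derivative_const])
    then show "(x has_vector_derivative A *v x t) (at t)"
      by (simp add: x_def matrix_vector_mult_flow[OF A])
  qed
  moreover have "infnorm (\<phi> t - x t) \<le> sqrt (\<beta>\<^sup>2 + M\<^sup>2) / (\<alpha> * \<beta>) * \<epsilon>" for t
  proof -
    obtain L where L: "((\<lambda>s. ?E (t - s) (\<phi> s)) \<longlongrightarrow> L) at_top"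
        "\<And>s. infnorm (?E (t - s) (\<phi> s) - L) \<le> exp (\<alpha> * t) * C * \<epsilon> / \<alpha> * exp (- \<alpha> * s)"
      using limit[of t] by blast
    \<comment> \<open>By the group law the limits for different \<open>t\<close> are the values of one solution.\<close>
    have "((\<lambda>s. ?E t (?E (0 - s) (\<phi> s))) \<longlongrightarrow> x t) at_top"
      unfolding x_def by (rule bounded_linear.tendsto[OF bounded_linear_flow x0])
    then have "((\<lambda>s. ?E (t - s) (\<phi> s)) \<longlongrightarrow> x t) at_top"
      by (simp add: flow_add[OF sq \<open>\<beta> \<noteq> 0\<close>, symmetric])
    then have "L = x t" using L(1) by (intro tendsto_unique) auto
    \<comment> \<open>At \<open>s = t\<close> the two exponential factors in the bound cancel.\<close>
    with L(2)[of t] show ?thesis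
      by (simp add: flow_0 C_def exp_minus field_simps)
  qed
  ultimately show "\<exists>x. solves_linear_system A x \<and>
      (\<forall>t. infnorm (\<phi> t - x t) \<le> sqrt (\<beta>\<^sup>2 + M\<^sup>2) / (\<alpha> * \<beta>) * \<epsilon>)"
    by blast
qed

lemma has_vector_derivative_reflect:
  fixes f :: "real \<Rightarrow> 'a::real_normed_vector"
  assumes "(f has_vector_derivative f') (at (- t))"
  shows "((\<lambda>t. f (- t)) has_vector_derivative - f') (at t)"
proof -
  have "(uminus has_vector_derivative (- 1 :: real)) (at t)"
    by (auto intro!: derivative_eq_intros)
  from vector_diff_chain_at[OF this, of f f'] assms show ?thesis
    by (simp add: o_def)
qed

lemma matrix_vector_mult_uminus_left: "(- A) *v v = - (A *v v)"
  for A :: "'a::ring_1 ^ 'n ^ 'm"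
  by (simp add: matrix_vector_mult_def vec_eq_iff sum_negf)

text \<open>If \<open>x\<close> solves the system of \<open>- A\<close>, then \<open>t \<mapsto> x (- t)\<close> solves that of \<open>A\<close>, and likewise for
  approximate solutions.\<close>

lemma hyers_ulam_stable_time_reversal:
  assumes "hyers_ulam_stable_with (- A) K"
  shows "hyers_ulam_stable_with A K"
  unfolding hyers_ulam_stable_with_def
proof (intro conjI allI impI)
  show "K > 0" using assms by (simp add: hyers_ulam_stable_with_def)
next
  fix \<epsilon> :: real and \<phi> :: "real \<Rightarrow> real ^ 2"
  assume "\<epsilon> > 0" and diff: "\<forall>t. \<phi> differentiable (at t)"
    and defect: "\<forall>t. infnorm (vector_derivative \<phi> (at t) - A *v \<phi> t) \<le> \<epsilon>"
  define \<psi> where "\<psi> t = \<phi> (- t)" for t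
  have der: "(\<psi> has_vector_derivative - vector_derivative \<phi> (at (- t))) (at t)" for t
    unfolding \<psi>_def
    by (rule has_vector_derivative_reflect) (simp add: diff vector_derivative_works[symmetric])
  have "\<forall>t. \<psi> differentiable (at t)"
    using der differentiableI_vector by blast
  moreover have "\<forall>t. infnorm (vector_derivative \<psi> (at t) - (- A) *v \<psi> t) \<le> \<epsilon>"
  proof
    fix t
    have "vector_derivative \<psi> (at t) - (- A) *v \<psi> t
        = - (vector_derivative \<phi> (at (- t)) - A *v \<phi> (- t))"
      by (simp add: vector_derivative_at[OF der] matrix_vector_mult_uminus_left \<psi>_def)
    then show "infnorm (vector_derivative \<psi> (at t) - (- A) *v \<psi> t) \<le> \<epsilon>"
      using defect by (metis infnorm_neg)
  qed
  ultimately obtain y where y: "solves_linear_system (- A) y"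
      "\<forall>t. infnorm (\<psi> t - y t) \<le> K * \<epsilon>"
    using assms \<open>\<epsilon> > 0\<close> unfolding hyers_ulam_stable_with_def by blast
  have "solves_linear_system A (\<lambda>t. y (- t))"
    unfolding solves_linear_system_def
  proof
    fix t
    have "(y has_vector_derivative (- A) *v y (- t)) (at (- t))"
      using y(1) unfolding solves_linear_system_def by blast
    from has_vector_derivative_reflect[OF this]
    show "((\<lambda>t. y (- t)) has_vector_derivative A *v y (- t)) (at t)"
      by (simp add: matrix_vector_mult_uminus_left)
  qed
  moreover have "infnorm (\<phi> t - y (- t)) \<le> K * \<epsilon>" for t
    using y(2)[rule_format, of "- t"] by (simp add: \<psi>_def)
  ultimately show "\<exists>x. solves_linear_system A x \<and> (\<forall>t. infnorm (\<phi> t - x t) \<le> K * \<epsilon>)"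
    by blast
qed

lemma hyers_ulam_stable_complex_eigenvalues:
  fixes A N :: "real ^ 2 ^ 2"
  assumes A: "\<And>v. A *v v = \<alpha> *\<^sub>R v + N *v v"
    and sq: "\<And>v. N *v (N *v v) = - \<beta>\<^sup>2 *\<^sub>R v"
    and N: "\<And>v. infnorm (N *v v) \<le> M * infnorm v"
    and "\<alpha> \<noteq> 0" and "\<beta> > 0"
  shows "hyers_ulam_stable_with A (sqrt (\<beta>\<^sup>2 + M\<^sup>2) / (\<bar>\<alpha>\<bar> * \<beta>))"
proof (cases "\<alpha> > 0")
  case True
  with hyers_ulam_stable_expanding[OF A sq N] \<open>\<beta> > 0\<close> show ?thesis by simp
next
  case False
  have "hyers_ulam_stable_with (- A) (sqrt (\<beta>\<^sup>2 + M\<^sup>2) / (- \<alpha> * \<beta>))"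
  proof (rule hyers_ulam_stable_expanding)
    fix v
    show "(- A) *v v = - \<alpha> *\<^sub>R v + (- N) *v v"
      by (simp add: matrix_vector_mult_uminus_left A)
    show "(- N) *v ((- N) *v v) = - \<beta>\<^sup>2 *\<^sub>R v"
      by (simp add: matrix_vector_mult_uminus_left linear_neg[OF matrix_vector_mul_linear] sq)
    show "infnorm ((- N) *v v) \<le> M * infnorm v"
      using N[of v] by (simp add: matrix_vector_mult_uminus_left infnorm_neg)
    show "- \<alpha> > 0" using False \<open>\<alpha> \<noteq> 0\<close> by simp
  qed fact
  then show ?thesis
    using False by (simp add: hyers_ulam_stable_time_reversal)
qed

section \<open>Real matrices of order two\<close>

text \<open>The eigenvalue is a root of the characteristic polynomial \<open>(a - \<lambda>) (d - \<lambda>) - b c\<close>. The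
  imaginary part of this equation gives the trace, and with it the real part gives the second
  conclusion, which says that the traceless part of the matrix squares to \<open>- \<beta>\<^sup>2 I\<close>.\<close>

lemma complex_eigenvalue_2x2:
  fixes a b c d \<alpha> \<beta> :: real and A :: "real ^ 2 ^ 2"
  assumes "Complex \<alpha> \<beta> \<in> eigenvalues (complex_matrix A)"
    and A: "A = vector [vector [a, b], vector [c, d]]" and "\<beta> \<noteq> 0"
  shows "d - \<alpha> = - (a - \<alpha>)" and "(a - \<alpha>)\<^sup>2 + b * c = - \<beta>\<^sup>2"
proof -
  let ?l = "Complex \<alpha> \<beta>"
  obtain v :: "complex ^ 2" where "v \<noteq> 0" and "complex_matrix A *v v = ?l *s v"
    using assms(1) unfolding eigenvalues_def by blast
  then have v: "v $ 1 \<noteq> 0 \<or> v $ 2 \<noteq> 0"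
    and eqs: "(of_real a - ?l) * v $ 1 = - (of_real b * v $ 2)"
      "(of_real d - ?l) * v $ 2 = - (of_real c * v $ 1)"
    by (auto simp: A vec_eq_iff forall_2 complex_matrix_def matrix_vector_mult_def sum_2 algebra_simps
        add_eq_0_iff)
  have "((of_real a - ?l) * (of_real d - ?l) - of_real b * of_real c) * v $ 1 = 0"
    and "((of_real a - ?l) * (of_real d - ?l) - of_real b * of_real c) * v $ 2 = 0"
    using eqs by algebra+
  then have "(of_real a - ?l) * (of_real d - ?l) = of_real b * of_real c"
    using v by auto
  then have re: "(a - \<alpha>) * (d - \<alpha>) - \<beta> * \<beta> = b * c" and im: "\<beta> * ((a - \<alpha>) + (d - \<alpha>)) = 0"
    by (simp_all add: complex_eq_iff algebra_simps)
  from im \<open>\<beta> \<noteq> 0\<close> show d: "d - \<alpha> = - (a - \<alpha>)" by simp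
  show "(a - \<alpha>)\<^sup>2 + b * c = - \<beta>\<^sup>2"
    using re unfolding d by (simp add: power2_eq_square algebra_simps)
qed

lemma matrix_vector_mult_2x2:
  fixes p q r s :: "'a::semiring_1"
  shows "(vector [vector [p, q], vector [r, s]] :: 'a ^ 2 ^ 2) *v v
    = vector [p * v $ 1 + q * v $ 2, r * v $ 1 + s * v $ 2]"
  by (simp add: vec_eq_iff forall_2 matrix_vector_mult_def sum_2)

lemma infnorm_matrix_vector_mult_2x2_le:
  fixes p q r s :: real
  assumes "\<bar>p\<bar> + \<bar>q\<bar> \<le> M" and "\<bar>r\<bar> + \<bar>s\<bar> \<le> M"
  shows "infnorm ((vector [vector [p, q], vector [r, s]] :: real ^ 2 ^ 2) *v v) \<le> M * infnorm v"
proof -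
  have row: "\<bar>x * v $ 1 + y * v $ 2\<bar> \<le> M * infnorm v" if "\<bar>x\<bar> + \<bar>y\<bar> \<le> M" for x y
  proof -
    have "\<bar>x * v $ 1 + y * v $ 2\<bar> \<le> \<bar>x\<bar> * \<bar>v $ 1\<bar> + \<bar>y\<bar> * \<bar>v $ 2\<bar>"
      by (metis abs_mult abs_triangle_ineq)
    also have "\<dots> \<le> \<bar>x\<bar> * infnorm v + \<bar>y\<bar> * infnorm v"
      by (intro add_mono mult_left_mono component_le_infnorm_cart) simp_all
    also have "\<dots> \<le> M * infnorm v"
      using that by (simp add: distrib_right[symmetric] mult_right_mono infnorm_pos_le)
    finally show ?thesis .
  qed
  show ?thesis
    unfolding matrix_vector_mult_2x2 infnorm_2 using row[OF assms(1)] row[OF assms(2)]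
    by (simp add: infnorm_2)
qed

theorem theorem3p3:
  fixes a b c d \<alpha> \<beta> :: real and A :: "real ^ 2 ^ 2"
  assumes "A = vector [vector [a, b], vector [c, d]]"
    and "eigenvalues (complex_matrix A) = {Complex \<alpha> \<beta>, Complex \<alpha> (- \<beta>)}"
    and "\<alpha> \<noteq> 0" and "\<beta> > 0"
  shows "hyers_ulam_stable_with A
           (sqrt (\<beta>\<^sup>2 + (\<bar>a - \<alpha>\<bar> + max \<bar>b\<bar> \<bar>c\<bar>)\<^sup>2) / (\<bar>\<alpha>\<bar> * \<beta>))"
proof -
  have "Complex \<alpha> \<beta> \<in> eigenvalues (complex_matrix A)" and "\<beta> \<noteq> 0"
    using assms(2,4) by simp_all
  note pair = complex_eigenvalue_2x2[OF this(1) assms(1) this(2)]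
  from pair(1) have d: "d = 2 * \<alpha> - a" by simp
  define N :: "real ^ 2 ^ 2" where "N = vector [vector [a - \<alpha>, b], vector [c, - (a - \<alpha>)]]"
  show ?thesis
  proof (rule hyers_ulam_stable_complex_eigenvalues)
    fix v
    show "A *v v = \<alpha> *\<^sub>R v + N *v v"
      by (simp add: assms(1) d N_def matrix_vector_mult_2x2 vec_eq_iff forall_2 algebra_simps)
    have "N *v (N *v v) = ((a - \<alpha>)\<^sup>2 + b * c) *\<^sub>R v"
      by (simp add: N_def matrix_vector_mult_2x2 vec_eq_iff forall_2 power2_eq_square algebra_simps)
    then show "N *v (N *v v) = - \<beta>\<^sup>2 *\<^sub>R v" by (simp only: pair(2))
    show "infnorm (N *v v) \<le> (\<bar>a - \<alpha>\<bar> + max \<bar>b\<bar> \<bar>c\<bar>) * infnorm v"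
      unfolding N_def by (rule infnorm_matrix_vector_mult_2x2_le) (simp_all add: abs_minus_commute)
  qed fact+
qed

end
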